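(* In the setting of the context, let $K$ be the number of connected components of the graph $([d],\mathcal E_s)$ and $\mathbf C_I\in\mathbb R^{d\times K}$ the matrix whose columns are the indicator vectors of these components. Then the rank condition $$\mathrm{rank}\big([\mathbf C_I,\ \mathfrak A\mathbf V]\big)=d_\theta+K\qquad( * )$$ holds if and only if $\mathbf W:=\mathbf V^\top\mathfrak A^\top\mathbf L\mathfrak A\mathbf V\in\mathbb R^{d_\theta\times d_\theta}$ is positive definite. Moreover, if $( * )$ fails, let $\mathbf Q_+$ and $\mathbf Q_\perp$ have orthonormal columns spanning the range and the null space of $\mathbf W$, respectively. Then augmenting $\mathbf A\mathbf w=\mathbf b$ with $(\mathbf V\mathbf Q_\perp)^\top\mathbf w=\mathbf 0$ yields an identifiable model: for any $\mathbf w,\mathbf w'$ satisfying both $\mathbf A\mathbf w=\mathbf b$ and $(\mathbf V\mathbf Q_\perp)^\top\mathbf w=\mathbf 0$, equality $p_\alpha(\mathbf w)=p_\alpha(\mathbf w')$ for all $\alpha\in\mathcal E_s$ implies $\mathbf w=\mathbf w'$. Further, for any $\mathbf w^\star=\mathbf w_o+\mathbf V\theta^\star$ with $\theta^\star\in\mathbb R^{d_\theta}$, the vector $$\tilde{\mathbf w}^\star:=\mathbf w_o+\mathbf V\mathbf Q_+\mathbf Q_+^\top\theta^\star$$ is the unique parameter satisfying $\mathbf A\mathbf w=\mathbf b$ and $(\mathbf V\mathbf Q_\perp)^\top\mathbf w=\mathbf 0$ such that $p_\alpha(\tilde{\mathbf w}^\star)=p_\alpha(\mathbf w^\star)$ for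 every $\alpha\in\mathcal E_s$.
   Context: Fix an integer $d$, feature vectors $\phi(\mathbf x_1),\dots,\phi(\mathbf x_d)\in\mathbb R^p$, the matrix $\mathfrak A\in\mathbb R^{d\times p}$ with rows $\phi(\mathbf x_i)^\top$, a scale $0<\sigma<\infty$, and a consistent linear system $\mathbf A\mathbf w=\mathbf b$ with $\mathbf A\in\mathbb R^{l\times p}$, $\mathbf b\in\mathbb R^l$. Let $r_A=\mathrm{rank}(\mathbf A)$, $d_\theta=p-r_A$, let $\mathbf V\in\mathbb R^{p\times d_\theta}$ have orthonormal columns spanning $\mathrm{Null}(\mathbf A)$, and let $\mathbf w_o=\mathbf A^\dagger\mathbf b$ (Moore–Penrose pseudoinverse). Let $\mathcal E_s\subseteq\{(i,j):1\le i<j\le d\}$ be a nonempty set of queried pairs with integer weights $n_\alpha\ge1$, $N=\sum_{\alpha\in\mathcal E_s}n_\alpha$. For $\alpha=(i,j)\in\mathcal E_s$ let $\mathbf a_\alpha=\mathfrak A^\top(\mathbf e_i-\mathbf e_j)$ and $p_\alpha(\mathbf w)=\dfrac1{1+\exp(-\mathbf w^\top\mathbf a_\alpha/\sigma)}$. The weighted graph Laplacian is $\mathbf L=\frac1N\sum_{\alpha=(i,j)\in\mathcal E_s}n_\alpha(\mathbf e_i-\mathbf e_j)(\mathbf e_i-\mathbf e_j)^\top$. Isolated vertices form their own connected components. *)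

theory Defs
  imports Complex_Main
    "Jordan_Normal_Form.DL_Rank"
    "Jordan_Normal_Form.Matrix_Kernel"
    "Graph_Theory.Digraph_Component"
begin

text \<open>
  Vertices and coordinates are numbered from 0, so the items are \<open>0, ..., d - 1\<close>, and
  matrices may have zero rows or columns.
\<close>

subsection \<open>Matrices\<close>

definition append_cols :: "'a::zero mat \<Rightarrow> 'a mat \<Rightarrow> 'a mat" where
  "append_cols A B = mat_of_cols (dim_row A) (cols A @ cols B)"

definition orthonormal_cols :: "real mat \<Rightarrow> bool" where
  "orthonormal_cols Q \<longleftrightarrow>
     (\<forall>i<dim_col Q. \<forall>j<dim_col Q. col Q i \<bullet> col Q j = (if i = j then 1 else 0))"

definition positive_definite :: "real mat \<Rightarrow> bool" where
  "positive_definite M \<longleftrightarrow>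
     square_mat M \<and> M\<^sup>T = M \<and>
     (\<forall>x\<in>carrier_vec (dim_row M). x \<noteq> 0\<^sub>v (dim_row M) \<longrightarrow> x \<bullet> (M *\<^sub>v x) > 0)"

text \<open>The Moore--Penrose pseudoinverse, by the four Penrose conditions.\<close>

definition is_pseudoinverse :: "real mat \<Rightarrow> real mat \<Rightarrow> bool" where
  "is_pseudoinverse A X \<longleftrightarrow>
     X \<in> carrier_mat (dim_col A) (dim_row A) \<and>
     A * X * A = A \<and> X * A * X = X \<and> (A * X)\<^sup>T = A * X \<and> (X * A)\<^sup>T = X * A"

definition pseudoinverse :: "real mat \<Rightarrow> real mat" where
  "pseudoinverse A = (THE X. is_pseudoinverse A X)"

subsection \<open>The comparison graph\<close>

text \<open>
  A set \<open>E\<close> of pairs stands for the undirected graph on \<open>{..<d}\<close>. The connected components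
  (as vertex sets) are the strongly connected components of the symmetrised digraph; an
  isolated vertex is a component of its own.
\<close>

definition comparison_graph :: "nat \<Rightarrow> (nat \<times> nat) set \<Rightarrow> nat pair_pre_digraph" where
  "comparison_graph d E = \<lparr>pverts = {..<d}, parcs = E\<rparr>"

definition connected_components :: "nat \<Rightarrow> (nat \<times> nat) set \<Rightarrow> nat set set" where
  "connected_components d E =
     pre_digraph.sccs_verts (with_proj (mk_symmetric (with_proj (comparison_graph d E))))"

definition indicator_vec :: "nat \<Rightarrow> nat set \<Rightarrow> real vec" where
  "indicator_vec d S = vec d (\<lambda>i. of_bool (i \<in> S))"

text \<open>The vector \<open>e\<^sub>i - e\<^sub>j\<close>.\<close>

definition pair_vec :: "nat \<Rightarrow> nat \<times> nat \<Rightarrow> real vec" where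
  "pair_vec d \<alpha> = unit_vec d (fst \<alpha>) - unit_vec d (snd \<alpha>)"

text \<open>
  The sum of the rank-one matrices \<open>n\<^sub>\<alpha> (e\<^sub>i - e\<^sub>j) (e\<^sub>i - e\<^sub>j)\<^sup>T\<close> is written
  entrywise, since matrices of a fixed dimension do not form a type.
\<close>

definition laplacian :: "nat \<Rightarrow> (nat \<times> nat) set \<Rightarrow> (nat \<times> nat \<Rightarrow> nat) \<Rightarrow> real mat" where
  "laplacian d E n =
     (1 / real (\<Sum>\<alpha>\<in>E. n \<alpha>)) \<cdot>\<^sub>m
     mat d d (\<lambda>(r, s). \<Sum>\<alpha>\<in>E. real (n \<alpha>) * (pair_vec d \<alpha> $ r * pair_vec d \<alpha> $ s))"

subsection \<open>The choice model\<close>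

text \<open>\<open>F\<close> is the matrix whose rows are the feature vectors.\<close>

definition feature_diff :: "real mat \<Rightarrow> nat \<times> nat \<Rightarrow> real vec" where
  "feature_diff F \<alpha> = F\<^sup>T *\<^sub>v pair_vec (dim_row F) \<alpha>"

definition choice_prob :: "real \<Rightarrow> real mat \<Rightarrow> nat \<times> nat \<Rightarrow> real vec \<Rightarrow> real" where
  "choice_prob \<sigma> F \<alpha> w = 1 / (1 + exp (- (w \<bullet> feature_diff F \<alpha>) / \<sigma>))"

end

theory Submission
  imports Defs
begin

text \<open>
  Put \<open>M = \<AA> V\<close>. The quadratic form of \<open>W = M\<^sup>T L M\<close> at \<open>x\<close> is the weighted mean over the queried
  pairs \<open>(i, j)\<close> of \<open>((M x)\<^sub>i - (M x)\<^sub>j)\<^sup>2\<close>, so it vanishes exactly when \<open>M x\<close> is constant on the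
  connected components, that is, when \<open>M x\<close> lies in the column space of \<open>C\<close>. The columns of \<open>C\<close>
  being independent, \<open>[C, M]\<close> has trivial kernel if and only if \<open>W\<close> is positive definite.

  Two solutions of \<open>A w = b\<close> differ by some \<open>V x\<close>, and they have the same choice probabilities if
  and only if \<open>M x\<close> is constant on the components, that is, \<open>W x = 0\<close>; the constraint with \<open>Q\<^sub>\<bottom>\<close>
  makes \<open>x\<close> orthogonal to the kernel of \<open>W\<close>, hence zero. Replacing \<open>\<theta>\<close> by its projection onto the
  range of \<open>W\<close> changes it by an element of the kernel.
\<close>

subsection \<open>Rank, column spaces and orthonormal columns\<close>

lemma mult_mat_unit_vec:
  fixes A :: "'a::semiring_1 mat"
  assumes "A \<in> carrier_mat n k" "j < k"
  shows "A *\<^sub>v unit_vec k j = col A j"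
  using assms by (metis col_mult2 col_one one_carrier_mat right_mult_one_mat)

context vec_space
begin

text \<open>Linear independence is a property of the set of columns and forgets repetitions, so
  distinctness is split off first. For distinct columns, nonzero kernel vectors are exactly linear
  dependences; with a repeated column both sides fail.\<close>

lemma rank_eq_dim_col_iff:
  assumes A: "A \<in> carrier_mat n nc"
  shows "rank A = nc \<longleftrightarrow> (\<forall>v\<in>carrier_vec nc. A *\<^sub>v v = 0\<^sub>v n \<longrightarrow> v = 0\<^sub>v nc)"
proof (cases "distinct (cols A)")
  case True
  show ?thesis
  proof
    assume "rank A = nc"
    then have "lin_indpt (set (cols A))"
      using full_rank_lin_indpt[OF A _ True] by blast
    then show "\<forall>v\<in>carrier_vec nc. A *\<^sub>v v = 0\<^sub>v n \<longrightarrow> v = 0\<^sub>v nc"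
      using lin_depI[OF A _ _ _ True] by blast
  next
    assume "\<forall>v\<in>carrier_vec nc. A *\<^sub>v v = 0\<^sub>v n \<longrightarrow> v = 0\<^sub>v nc"
    then have "lin_indpt (set (cols A))"
      using lin_depE[OF A _ True] by blast
    then show "rank A = nc"
      using lin_indpt_full_rank[OF A True] by blast
  qed
next
  case False
  obtain i j where ij: "i \<noteq> j" "i < nc" "j < nc" "col A i = col A j"
    using False A by (auto simp: distinct_conv_nth)
  have "lin_indpt {}"
    by (simp add: lin_dep_def)
  \<comment> \<open>The rank is the size of a maximal independent set of columns, and a repetition
    leaves fewer than \<open>nc\<close> different columns to choose from.\<close>
  then obtain S where S: "maximal S (\<lambda>T. T \<subseteq> set (cols A) \<and> lin_indpt T)"
    using maximal_exists_superset[of "set (cols A)" "\<lambda>T. T \<subseteq> set (cols A) \<and> lin_indpt T" "{}"]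
    by auto
  then have "card S \<le> card (set (cols A))"
    by (intro card_mono) (auto simp: maximal_def)
  also have "\<dots> < length (cols A)"
    using False card_length[of "cols A"] card_distinct[of "cols A"] by linarith
  also have "length (cols A) = nc"
    using A by simp
  finally have "rank A \<noteq> nc"
    using rank_card_indpt[OF A S] by simp
  \<comment> \<open>The kernel vector that witnesses the repetition: it subtracts column
    \<open>j\<close> from the equal column \<open>i\<close>.\<close>
  moreover define v :: "'a vec" where "v = unit_vec nc i - unit_vec nc j"
  have "A *\<^sub>v v = 0\<^sub>v n"
    using A ij unfolding v_def
    by (subst mult_minus_distrib_mat_vec[OF A]) (auto simp: mult_mat_unit_vec)
  moreover have "v $ i = 1"
    using ij by (simp add: v_def)
  then have "v \<noteq> 0\<^sub>v nc"
    using ij by auto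
  moreover have "v \<in> carrier_vec nc"
    by (simp add: v_def)
  ultimately show ?thesis
    by blast
qed

end

lemma append_cols_carrier:
  assumes "A \<in> carrier_mat n k" "B \<in> carrier_mat n m"
  shows "append_cols A B \<in> carrier_mat n (k + m)"
  using assms by (auto simp: append_cols_def)

lemma append_cols_mult_vec:
  assumes A: "A \<in> carrier_mat n k" and B: "B \<in> carrier_mat n m"
    and x: "x \<in> carrier_vec k" and y: "y \<in> carrier_vec m"
  shows "append_cols A B *\<^sub>v (x @\<^sub>v y) = A *\<^sub>v x + B *\<^sub>v y"
proof (rule eq_vecI)
  fix i assume "i < dim_vec (A *\<^sub>v x + B *\<^sub>v y)"
  then have i: "i < n"
    using B by simp
  have "row (append_cols A B) i = row A i @\<^sub>v row B i"
    using A B i by (intro eq_vecI) (auto simp: append_cols_def mat_of_cols_def nth_append)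
  then show "(append_cols A B *\<^sub>v (x @\<^sub>v y)) $ i = (A *\<^sub>v x + B *\<^sub>v y) $ i"
    using A B x y i append_cols_carrier[OF A B]
    by (simp add: scalar_prod_append[of _ k _ m])
qed (use A B in \<open>simp add: append_cols_def\<close>)

lemma vec_space_col_space_iff:
  fixes A :: "'a::field mat"
  assumes "A \<in> carrier_mat n k"
  shows "y \<in> vec_space.col_space n A \<longleftrightarrow> (\<exists>x\<in>carrier_vec k. A *\<^sub>v x = y)"
proof -
  interpret vec_space "TYPE('a)" n .
  show ?thesis
    using assms by (auto simp: col_space_eq[OF assms])
qed

lemma orthonormal_cols_transpose_mult:
  assumes "Q \<in> carrier_mat n k" "orthonormal_cols Q"
  shows "Q\<^sup>T * Q = 1\<^sub>m k"
  using assms by (intro eq_matI) (auto simp: orthonormal_cols_def)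

lemma orthonormal_cols_cancel:
  assumes Q: "Q \<in> carrier_mat n k" "orthonormal_cols Q" and x: "x \<in> carrier_vec k"
  shows "Q\<^sup>T *\<^sub>v (Q *\<^sub>v x) = x"
  using assms orthonormal_cols_transpose_mult[OF Q]
  by (metis assoc_mult_mat_vec one_mult_mat_vec transpose_carrier_mat)

lemma scalar_prod_self_eq_0_iff:
  fixes x :: "real vec"
  assumes "x \<in> carrier_vec n"
  shows "x \<bullet> x = 0 \<longleftrightarrow> x = 0\<^sub>v n"
proof -
  have "x \<bullet> x = 0 \<longleftrightarrow> (\<forall>i\<in>{0..<dim_vec x}. x $ i * x $ i = 0)"
    unfolding scalar_prod_def by (rule sum_nonneg_eq_0_iff) auto
  then show ?thesis
    using assms by auto
qed

subsection \<open>The pseudoinverse\<close>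

text \<open>\<open>A * X\<close> and \<open>A * Y\<close> are symmetric projections with the same
  range. Hence \<open>A X = (A Y) (A X)\<close>, and transposing reverses the factors to
  \<open>(A X) (A Y) = A Y\<close>. The products with \<open>A\<close> on the right are treated the
  same way.\<close>

lemma is_pseudoinverse_mult_unique:
  assumes X: "is_pseudoinverse A X" and Y: "is_pseudoinverse A Y"
  shows "A * X = A * Y" "X * A = Y * A"
proof -
  let ?n = "dim_row A" and ?m = "dim_col A"
  have c: "A \<in> carrier_mat ?n ?m" "X \<in> carrier_mat ?m ?n" "Y \<in> carrier_mat ?m ?n"
    using X Y by (auto simp: is_pseudoinverse_def)
  have eX: "A * X * A = A" "(A * X)\<^sup>T = A * X" "(X * A)\<^sup>T = X * A"
    and eY: "A * Y * A = A" "(A * Y)\<^sup>T = A * Y" "(Y * A)\<^sup>T = Y * A"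
    using X Y by (auto simp: is_pseudoinverse_def)
  have "A * X = (A * Y * A) * X"
    by (simp only: eY)
  also have "\<dots> = (A * Y) * (A * X)"
    by (rule assoc_mult_mat[OF mult_carrier_mat[OF c(1) c(3)] c(1) c(2)])
  also have "\<dots> = (A * Y)\<^sup>T * (A * X)\<^sup>T"
    by (simp only: eX eY)
  also have "\<dots> = ((A * X) * (A * Y))\<^sup>T"
    by (rule transpose_mult[OF mult_carrier_mat[OF c(1) c(2)] mult_carrier_mat[OF c(1) c(3)], symmetric])
  also have "(A * X) * (A * Y) = (A * X * A) * Y"
    by (rule assoc_mult_mat[OF mult_carrier_mat[OF c(1) c(2)] c(1) c(3), symmetric])
  finally show "A * X = A * Y"
    by (simp only: eX eY)
  have "X * A = X * (A * (Y * A))"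
    using assoc_mult_mat[OF c(1) c(3) c(1)] by (simp only: eY)
  also have "\<dots> = (X * A) * (Y * A)"
    by (rule assoc_mult_mat[OF c(2) c(1) mult_carrier_mat[OF c(3) c(1)], symmetric])
  also have "\<dots> = (X * A)\<^sup>T * (Y * A)\<^sup>T"
    by (simp only: eX eY)
  also have "\<dots> = ((Y * A) * (X * A))\<^sup>T"
    by (rule transpose_mult[OF mult_carrier_mat[OF c(3) c(1)] mult_carrier_mat[OF c(2) c(1)], symmetric])
  also have "(Y * A) * (X * A) = Y * (A * (X * A))"
    by (rule assoc_mult_mat[OF c(3) c(1) mult_carrier_mat[OF c(2) c(1)]])
  also have "A * (X * A) = A"
    using assoc_mult_mat[OF c(1) c(2) c(1)] by (simp only: eX)
  finally show "X * A = Y * A"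
    by (simp only: eX eY)
qed

text \<open>The chain is \<open>X = X A X = X A Y = Y A Y = Y\<close>, exchanging one product at a
  time.\<close>

lemma is_pseudoinverse_unique:
  assumes X: "is_pseudoinverse A X" and Y: "is_pseudoinverse A Y"
  shows "X = Y"
proof -
  let ?n = "dim_row A" and ?m = "dim_col A"
  have c: "A \<in> carrier_mat ?n ?m" "X \<in> carrier_mat ?m ?n" "Y \<in> carrier_mat ?m ?n"
    using X Y by (auto simp: is_pseudoinverse_def)
  have e: "X * A * X = X" "Y * A * Y = Y"
    using X Y by (auto simp: is_pseudoinverse_def)
  have "X = X * (A * X)"
    using assoc_mult_mat[OF c(2) c(1) c(2)] by (simp only: e)
  also have "\<dots> = X * A * Y"
    using assoc_mult_mat[OF c(2) c(1) c(3)] by (simp only: is_pseudoinverse_mult_unique(1)[OF X Y])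
  also have "\<dots> = Y"
    by (simp only: is_pseudoinverse_mult_unique(2)[OF X Y] e)
  finally show ?thesis .
qed

lemma pseudoinverse_eqI:
  "is_pseudoinverse A X \<Longrightarrow> pseudoinverse A = X"
  unfolding pseudoinverse_def by (rule the_equality) (auto dest: is_pseudoinverse_unique)

text \<open>
  Since \<open>A V = 0\<close>, the matrix \<open>G = A\<^sup>T A + V V\<^sup>T\<close> is invertible and fixes the columns of
  \<open>V\<close>; the pseudoinverse of \<open>A\<close> is \<open>G\<^sup>-\<^sup>1 A\<^sup>T\<close>.
\<close>

lemma
  assumes A: "A \<in> carrier_mat l p" and V: "V \<in> carrier_mat p k"
    and ortho: "orthonormal_cols V" and span: "vec_space.col_space p V = mat_kernel A"
  shows is_pseudoinverse_pseudoinverse: "is_pseudoinverse A (pseudoinverse A)"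
    and transpose_kernel_mult_pseudoinverse: "V\<^sup>T * pseudoinverse A = 0\<^sub>m k l"
proof -
  have AT: "A\<^sup>T \<in> carrier_mat p l" and VT: "V\<^sup>T \<in> carrier_mat k p"
    using A V by auto
  have AVx: "A *\<^sub>v (V *\<^sub>v x) = 0\<^sub>v l" if "x \<in> carrier_vec k" for x
  proof -
    have "V *\<^sub>v x \<in> mat_kernel A"
      using that unfolding span[symmetric] vec_space_col_space_iff[OF V] by blast
    then show ?thesis
      using mat_kernelD[OF A] by blast
  qed
  have AV: "A * V = 0\<^sub>m l k"
  proof (rule eq_matI)
    fix i j assume ij: "i < dim_row (0\<^sub>m l k :: real mat)" "j < dim_col (0\<^sub>m l k :: real mat)"
    have "A *\<^sub>v col V j = 0\<^sub>v l"
      using AVx[of "unit_vec k j"] ij by (simp add: mult_mat_unit_vec[OF V])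
    then have "(A * V) $$ (i, j) = 0\<^sub>v l $ i"
      using ij A V by (metis carrier_matD index_mult_mat(1) index_mult_mat_vec index_zero_mat(2,3))
    then show "(A * V) $$ (i, j) = 0\<^sub>m l k $$ (i, j)"
      using ij by simp
  qed (use carrier_matD[OF A] carrier_matD[OF V] in simp_all)
  have VA: "V\<^sup>T * A\<^sup>T = 0\<^sub>m k l"
    unfolding transpose_mult[OF A V, symmetric] AV by auto
  \<comment> \<open>\<open>P\<close> is the orthogonal projection onto the kernel of
    \<open>A\<close>, so \<open>G\<close> is the identity there and acts as
    \<open>A\<^sup>T * A\<close> on the orthogonal complement.\<close>
  define P where "P = V * V\<^sup>T"
  define G where "G = A\<^sup>T * A + P"
  have P: "P \<in> carrier_mat p p"
    unfolding P_def using V VT by (rule mult_carrier_mat)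
  have AA: "A\<^sup>T * A \<in> carrier_mat p p"
    using AT A by (rule mult_carrier_mat)
  have G: "G \<in> carrier_mat p p"
    using P by (simp add: G_def)
  have Psym: "P\<^sup>T = P"
    unfolding P_def by (simp add: transpose_mult[OF V VT])
  have AAsym: "(A\<^sup>T * A)\<^sup>T = A\<^sup>T * A"
    by (simp add: transpose_mult[OF AT A])
  have Gsym: "G\<^sup>T = G"
    using Psym AAsym by (simp add: G_def transpose_add[OF AA P])
  have AP: "A * P = 0\<^sub>m l p"
    unfolding P_def using AV assoc_mult_mat[OF A V VT] left_mult_zero_mat[OF VT] by simp
  have GV: "G * V = V"
  proof -
    have "G * V = A\<^sup>T * A * V + P * V"
      unfolding G_def using AA P V by (rule add_mult_distrib_mat)
    also have "A\<^sup>T * A * V = 0\<^sub>m p k"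
      using AV assoc_mult_mat[OF AT A V] right_mult_zero_mat[OF AT] by simp
    also have "P * V = V"
      unfolding P_def using orthonormal_cols_transpose_mult[OF V ortho] assoc_mult_mat[OF V VT V]
        right_mult_one_mat[OF V] by simp
    finally show ?thesis
      using V by simp
  qed
  \<comment> \<open>If \<open>G v = 0\<close>, pairing with \<open>v\<close> gives
    \<open>|A v|^2 + |V\<^sup>T v|^2 = 0\<close>. Then \<open>v\<close> lies in the kernel of
    \<open>A\<close>, so \<open>v = V x\<close>, while \<open>V\<^sup>T v = 0\<close> forces
    \<open>x = 0\<close>.\<close>
  have "det G \<noteq> 0"
  proof
    assume "det G = 0"
    then obtain v where v: "v \<in> carrier_vec p" "v \<noteq> 0\<^sub>v p" "G *\<^sub>v v = 0\<^sub>v p"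
      using det_0_iff_vec_prod_zero_field[OF G] by blast
    have Av: "A *\<^sub>v v \<in> carrier_vec l" "V\<^sup>T *\<^sub>v v \<in> carrier_vec k"
      using v by (auto intro: mult_mat_vec_carrier[OF A] mult_mat_vec_carrier[OF VT])
    have Gv: "G *\<^sub>v v = A\<^sup>T *\<^sub>v (A *\<^sub>v v) + V *\<^sub>v (V\<^sup>T *\<^sub>v v)"
      using add_mult_distrib_mat_vec[OF AA P v(1)] assoc_mult_mat_vec[OF AT A v(1)]
        assoc_mult_mat_vec[OF V VT v(1)] by (simp only: G_def P_def)
    have "0 = (A\<^sup>T *\<^sub>v (A *\<^sub>v v) + V *\<^sub>v (V\<^sup>T *\<^sub>v v)) \<bullet> v"
      unfolding Gv[symmetric] v(3) using v(1) by simp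
    also have "\<dots> = (A\<^sup>T *\<^sub>v (A *\<^sub>v v)) \<bullet> v + (V *\<^sub>v (V\<^sup>T *\<^sub>v v)) \<bullet> v"
      using mult_mat_vec_carrier[OF AT Av(1)] mult_mat_vec_carrier[OF V Av(2)] v(1)
      by (rule add_scalar_prod_distrib)
    also have "(A\<^sup>T *\<^sub>v (A *\<^sub>v v)) \<bullet> v = (A *\<^sub>v v) \<bullet> (A *\<^sub>v v)"
      using A v(1) Av(1) by (rule transpose_vec_mult_scalar)
    also have "(V *\<^sub>v (V\<^sup>T *\<^sub>v v)) \<bullet> v = (V\<^sup>T *\<^sub>v v) \<bullet> (V\<^sup>T *\<^sub>v v)"
      using transpose_vec_mult_scalar[OF VT v(1) Av(2)] by simp
    finally have "(A *\<^sub>v v) \<bullet> (A *\<^sub>v v) + (V\<^sup>T *\<^sub>v v) \<bullet> (V\<^sup>T *\<^sub>v v) = 0"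
      by simp
    moreover have "(A *\<^sub>v v) \<bullet> (A *\<^sub>v v) \<ge> 0" "(V\<^sup>T *\<^sub>v v) \<bullet> (V\<^sup>T *\<^sub>v v) \<ge> 0"
      by (auto simp: scalar_prod_def intro: sum_nonneg)
    ultimately have "(A *\<^sub>v v) \<bullet> (A *\<^sub>v v) = 0" "(V\<^sup>T *\<^sub>v v) \<bullet> (V\<^sup>T *\<^sub>v v) = 0"
      by linarith+
    then have Av0: "A *\<^sub>v v = 0\<^sub>v l" and Vv0: "V\<^sup>T *\<^sub>v v = 0\<^sub>v k"
      using scalar_prod_self_eq_0_iff Av by blast+
    then have "v \<in> vec_space.col_space p V"
      unfolding span using mat_kernelI[OF A] v by blast
    then obtain x where x: "x \<in> carrier_vec k" "V *\<^sub>v x = v"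
      unfolding vec_space_col_space_iff[OF V] by blast
    then have "x = 0\<^sub>v k"
      using orthonormal_cols_cancel[OF V ortho x(1)] Vv0 by simp
    then show False
      using x v V by auto
  qed
  then obtain H where H: "H \<in> carrier_mat p p" and HG: "H * G = 1\<^sub>m p" and GH: "G * H = 1\<^sub>m p"
    using det_non_zero_imp_unit[OF G, of "()"] by (auto simp: Units_def ring_mat_def)
  \<comment> \<open>The inverse of a symmetric matrix is symmetric: \<open>H\<^sup>T\<close> is a
    left inverse of \<open>G\<close> too, and cancelling against \<open>H\<close> identifies the
    two.\<close>
  have Hsym: "H\<^sup>T = H"
  proof -
    have "H\<^sup>T * G = (G * H)\<^sup>T"
      using transpose_mult[OF G H] by (simp add: Gsym)
    also have "\<dots> = 1\<^sub>m p"
      by (simp add: GH)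
    finally have "H\<^sup>T * G * H = H"
      using left_mult_one_mat[OF H] by simp
    moreover have "H\<^sup>T * G * H = H\<^sup>T"
      using GH assoc_mult_mat[OF _ G H, of "H\<^sup>T" p] right_mult_one_mat[of "H\<^sup>T" p p] H by simp
    ultimately show ?thesis
      by simp
  qed
  have HV: "H * V = V"
    using GV HG assoc_mult_mat[OF H G V] left_mult_one_mat[OF V] by simp
  have VH: "V\<^sup>T * H = V\<^sup>T"
    using HV Hsym transpose_mult[OF H V] by simp
  define X where "X = H * A\<^sup>T"
  have X: "X \<in> carrier_mat p l"
    unfolding X_def using H AT by (rule mult_carrier_mat)
  have VX: "V\<^sup>T * X = 0\<^sub>m k l"
    unfolding X_def using VA VH assoc_mult_mat[OF VT H AT] by simp
  \<comment> \<open>Expanding \<open>H G = 1\<close> with \<open>H P = P\<close> shows that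
    \<open>X A\<close> is the projection onto the complement of the kernel. The Penrose conditions
    reduce to this: \<open>A P = 0\<close> gives the first, \<open>P X = 0\<close> the second, and
    the symmetry of \<open>H\<close> and \<open>P\<close> the last two.\<close>
  have XA: "X * A = 1\<^sub>m p - P"
  proof -
    have "X * A = H * (A\<^sup>T * A)"
      unfolding X_def using H AT A by (rule assoc_mult_mat)
    moreover have "H * G = H * (A\<^sup>T * A) + H * P"
      unfolding G_def using H AA P by (rule mult_add_distrib_mat)
    moreover have "H * P = P"
      unfolding P_def using HV assoc_mult_mat[OF H V VT] by simp
    ultimately have e: "1\<^sub>m p = X * A + P"
      using HG by simp
    show ?thesis
      unfolding e using A X P by (intro eq_matI) auto
  qed
  have AXA: "A * X * A = A"
  proof -
    have "A * X * A = A * (1\<^sub>m p - P)"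
      unfolding assoc_mult_mat[OF A X A] XA ..
    also have "\<dots> = A * 1\<^sub>m p - A * P"
      using A one_carrier_mat P by (rule mult_minus_distrib_mat)
    also have "\<dots> = A"
      using A by (intro eq_matI) (auto simp: AP)
    finally show ?thesis .
  qed
  have XAX: "X * A * X = X"
  proof -
    have "X * A * X = 1\<^sub>m p * X - P * X"
      unfolding XA using one_carrier_mat P X by (rule minus_mult_distrib_mat)
    also have "P * X = 0\<^sub>m p l"
      unfolding P_def using VX assoc_mult_mat[OF V VT X] right_mult_zero_mat[OF V] by simp
    also have "1\<^sub>m p * X - 0\<^sub>m p l = X"
      using X by (intro eq_matI) auto
    finally show ?thesis .
  qed
  have AXsym: "(A * X)\<^sup>T = A * X"
  proof -
    have "(A * X)\<^sup>T = X\<^sup>T * A\<^sup>T"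
      by (rule transpose_mult[OF A X])
    also have "X\<^sup>T = A * H"
      unfolding X_def by (simp add: transpose_mult[OF H AT] Hsym)
    also have "A * H * A\<^sup>T = A * X"
      unfolding X_def using A H AT by (rule assoc_mult_mat)
    finally show ?thesis .
  qed
  have XAsym: "(X * A)\<^sup>T = X * A"
    unfolding XA using Psym transpose_minus[OF one_carrier_mat P] by simp
  have "is_pseudoinverse A X"
    using A X AXA XAX AXsym XAsym by (auto simp: is_pseudoinverse_def)
  moreover from this have "pseudoinverse A = X"
    by (rule pseudoinverse_eqI)
  ultimately show "is_pseudoinverse A (pseudoinverse A)" "V\<^sup>T * pseudoinverse A = 0\<^sub>m k l"
    using VX by auto
qed

subsection \<open>Connected components and the Laplacian\<close>

text \<open>The components partition the vertices. The two ends of a pair are mutually reachable in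
  the symmetrised graph, so they share a component; conversely, a function that agrees on the ends
  of every pair is constant along walks.\<close>

lemma
  assumes E: "E \<subseteq> {..<d} \<times> {..<d}"
  shows connected_components_subset: "S \<in> connected_components d E \<Longrightarrow> S \<subseteq> {..<d}"
    and connected_components_nonempty: "S \<in> connected_components d E \<Longrightarrow> S \<noteq> {}"
    and connected_components_disjoint:
      "\<lbrakk>S \<in> connected_components d E; T \<in> connected_components d E; S \<noteq> T\<rbrakk> \<Longrightarrow> S \<inter> T = {}"
    and connected_components_cover: "i < d \<Longrightarrow> \<exists>S\<in>connected_components d E. i \<in> S"
    and constant_on_connected_components_iff:
      "(\<forall>S\<in>connected_components d E. \<forall>i\<in>S. \<forall>j\<in>S. f i = f j) \<longleftrightarrow> (\<forall>(i, j)\<in>E. f i = f j)"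
proof -
  \<comment> \<open>Symmetrising adds every reversed arc, so strong connectivity becomes undirected
    connectivity.\<close>
  let ?G = "mk_symmetric (with_proj (comparison_graph d E))"
  have parcs: "parcs ?G = E \<union> E\<inverse>" and pverts: "pverts ?G = {..<d}"
    by (auto simp: parcs_mk_symmetric comparison_graph_def)
  interpret pair_wf_digraph ?G
    by unfold_locales (use E parcs pverts in auto)
  have cc: "connected_components d E = sccs_verts"
    by (simp add: connected_components_def)
  show "S \<in> connected_components d E \<Longrightarrow> S \<subseteq> {..<d}"
    unfolding cc using sccs_verts_subsets pverts by auto
  show "S \<in> connected_components d E \<Longrightarrow> S \<noteq> {}"
    unfolding cc in_sccs_verts_conv_reachable by blast
  show "\<lbrakk>S \<in> connected_components d E; T \<in> connected_components d E; S \<noteq> T\<rbrakk> \<Longrightarrow> S \<inter> T = {}"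
    unfolding cc by (rule sccs_verts_disjoint)
  have scc_of: "scc_of i \<in> sccs_verts" "i \<in> scc_of i" if "i < d" for i
    using that pverts by (auto simp: scc_of_in_sccs_verts in_scc_of_self)
  show "i < d \<Longrightarrow> \<exists>S\<in>connected_components d E. i \<in> S"
    unfolding cc using scc_of by blast
  show "(\<forall>S\<in>connected_components d E. \<forall>i\<in>S. \<forall>j\<in>S. f i = f j) \<longleftrightarrow> (\<forall>(i, j)\<in>E. f i = f j)"
  proof
    assume const: "\<forall>S\<in>connected_components d E. \<forall>i\<in>S. \<forall>j\<in>S. f i = f j"
    have "f i = f j" if "(i, j) \<in> E" for i j
    proof -
      have "i < d" "j < d"
        using that E by auto
      moreover have "i \<rightarrow>\<^sup>*\<^bsub>with_proj ?G\<^esub> j" "j \<rightarrow>\<^sup>*\<^bsub>with_proj ?G\<^esub> i"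
        using that parcs by (auto intro!: reachable_adjI)
      ultimately have "j \<in> scc_of i"
        by (simp add: scc_of_def)
      then show ?thesis
        using const scc_of[OF \<open>i < d\<close>] unfolding cc by blast
    qed
    then show "\<forall>(i, j)\<in>E. f i = f j"
      by blast
  next
    assume edge: "\<forall>(i, j)\<in>E. f i = f j"
    \<comment> \<open>Induction along the walk; its last arc is a pair of \<open>E\<close> in one of
      the two orientations.\<close>
    have "f i = f j" if "i \<rightarrow>\<^sup>*\<^bsub>with_proj ?G\<^esub> j" for i j
      using that
    proof (induction rule: reachable_induct)
      case (step x y)
      then have "(x, y) \<in> E \<or> (y, x) \<in> E"
        using parcs by auto
      then show ?case
        using edge step.IH by force
    qed simp
    then show "\<forall>S\<in>connected_components d E. \<forall>i\<in>S. \<forall>j\<in>S. f i = f j"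
      unfolding cc using in_sccs_verts_conv_reachable by blast
  qed
qed

section \<open>The matrix of component indicators and the rank condition\<close>

definition component_matrix :: "nat \<Rightarrow> nat set list \<Rightarrow> real mat" where
  "component_matrix d Ss = mat_of_cols d (map (indicator_vec d) Ss)"

lemma component_matrix_carrier: "component_matrix d Ss \<in> carrier_mat d (length Ss)"
  unfolding component_matrix_def by (metis length_map mat_of_cols_carrier(1))

text \<open>By disjointness, vertex \<open>i\<close> belongs to component \<open>k\<close> alone, so
  row \<open>i\<close> of the matrix is the unit vector at position \<open>k\<close>.\<close>

lemma component_matrix_mult_vec:
  assumes "distinct Ss" and disj: "\<And>S T. \<lbrakk>S \<in> set Ss; T \<in> set Ss; S \<noteq> T\<rbrakk> \<Longrightarrow> S \<inter> T = {}"
    and c: "c \<in> carrier_vec (length Ss)" and k: "k < length Ss" and i: "i \<in> Ss ! k" "i < d"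
  shows "(component_matrix d Ss *\<^sub>v c) $ i = c $ k"
proof -
  have mem: "i \<in> Ss ! m \<longleftrightarrow> m = k" if "m < length Ss" for m
    using assms that by (metis disjoint_iff nth_eq_iff_index_eq nth_mem)
  have "(component_matrix d Ss *\<^sub>v c) $ i = (\<Sum>m = 0..<length Ss. indicator_vec d (Ss ! m) $ i * c $ m)"
    using c i(2) by (auto simp: component_matrix_def scalar_prod_def mat_of_cols_def intro!: sum.cong)
  also have "\<dots> = (\<Sum>m = 0..<length Ss. if m = k then c $ m else 0)"
    using i(2) mem by (intro sum.cong) (auto simp: indicator_vec_def)
  also have "\<dots> = c $ k"
    using k by simp
  finally show ?thesis .
qed

text \<open>A kernel vector of the block matrix is a pair \<open>(c, x)\<close> with
  \<open>C c = - M x\<close>. Some \<open>c\<close> completes \<open>x\<close> to such a pair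
  exactly when \<open>M x\<close> is constant on components, and \<open>c\<close> is then determined
  by \<open>x\<close> because components are nonempty. Full column rank thus becomes a condition on
  \<open>x\<close> alone.\<close>

lemma rank_append_component_matrix_iff:
  assumes E: "E \<subseteq> {..<d} \<times> {..<d}"
    and Ss: "distinct Ss" "set Ss = connected_components d E" and M: "M \<in> carrier_mat d k"
  shows "vec_space.rank d (append_cols (component_matrix d Ss) M) = k + length Ss \<longleftrightarrow>
    (\<forall>x\<in>carrier_vec k. (\<forall>(i, j)\<in>E. (M *\<^sub>v x) $ i = (M *\<^sub>v x) $ j) \<longrightarrow> x = 0\<^sub>v k)"
    (is "?rank \<longleftrightarrow> ?inj")
proof -
  interpret vec_space "TYPE(real)" d .
  let ?C = "component_matrix d Ss" and ?K = "length Ss"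
  note C = component_matrix_carrier[of d Ss]
  have Ss_nth: "Ss ! m \<in> connected_components d E" if "m < ?K" for m
    using that Ss(2) nth_mem by blast
  have C_mult: "(?C *\<^sub>v c) $ i = c $ m" if "c \<in> carrier_vec ?K" "m < ?K" "i \<in> Ss ! m" for c m i
    using that component_matrix_mult_vec[OF Ss(1)] connected_components_disjoint[OF E]
      connected_components_subset[OF E Ss_nth] Ss(2)
    by (metis lessThan_iff subsetD)
  have "?rank \<longleftrightarrow> (\<forall>v\<in>carrier_vec (?K + k). append_cols ?C M *\<^sub>v v = 0\<^sub>v d \<longrightarrow> v = 0\<^sub>v (?K + k))"
    using rank_eq_dim_col_iff[OF append_cols_carrier[OF C M]] by (simp add: add.commute)
  also have "\<dots> \<longleftrightarrow> ?inj"
  proof (intro iffI ballI impI)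
    fix x
    assume inj: "\<forall>v\<in>carrier_vec (?K + k). append_cols ?C M *\<^sub>v v = 0\<^sub>v d \<longrightarrow> v = 0\<^sub>v (?K + k)"
      and x: "x \<in> carrier_vec k" and edge: "\<forall>(i, j)\<in>E. (M *\<^sub>v x) $ i = (M *\<^sub>v x) $ j"
    \<comment> \<open>The coefficient of a component is minus the common value of \<open>M x\<close>
      on it, read off at an arbitrary vertex.\<close>
    define c where "c = vec ?K (\<lambda>m. - ((M *\<^sub>v x) $ (SOME i. i \<in> Ss ! m)))"
    have c: "c \<in> carrier_vec ?K"
      by (simp add: c_def)
    have "?C *\<^sub>v c + M *\<^sub>v x = 0\<^sub>v d"
    proof (rule eq_vecI)
      fix i assume i: "i < dim_vec (0\<^sub>v d :: real vec)"
      then obtain m where m: "m < ?K" "i \<in> Ss ! m"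
        using connected_components_cover[OF E, of i] Ss(2) by (metis in_set_conv_nth index_zero_vec(2))
      then have "(SOME i. i \<in> Ss ! m) \<in> Ss ! m"
        by (metis someI)
      then have "(M *\<^sub>v x) $ (SOME i. i \<in> Ss ! m) = (M *\<^sub>v x) $ i"
        using m(2) Ss_nth[OF m(1)] edge
          constant_on_connected_components_iff[OF E, of "\<lambda>i. (M *\<^sub>v x) $ i"] by blast
      then have "c $ m = - ((M *\<^sub>v x) $ i)"
        using m(1) by (simp add: c_def)
      then show "(?C *\<^sub>v c + M *\<^sub>v x) $ i = 0\<^sub>v d $ i"
        using C_mult[OF c m] i M by simp
    qed (use M in simp)
    then have "c @\<^sub>v x = 0\<^sub>v (?K + k)"
      using inj c x by (simp add: append_cols_mult_vec[OF C M c x])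
    also have "\<dots> = 0\<^sub>v ?K @\<^sub>v 0\<^sub>v k"
      by auto
    finally show "x = 0\<^sub>v k"
      using append_vec_eq[OF c, of "0\<^sub>v ?K"] by simp
  next
    fix v assume inj: ?inj and v: "v \<in> carrier_vec (?K + k)" "append_cols ?C M *\<^sub>v v = 0\<^sub>v d"
    define c x where "c = vec_first v ?K" and "x = vec_last v k"
    have c: "c \<in> carrier_vec ?K" and x: "x \<in> carrier_vec k" and v_eq: "v = c @\<^sub>v x"
      using v(1) by (simp_all add: c_def x_def)
    have sum0: "?C *\<^sub>v c + M *\<^sub>v x = 0\<^sub>v d"
      using v(2) append_cols_mult_vec[OF C M c x] by (simp add: v_eq)
    have Mx: "(M *\<^sub>v x) $ i = - c $ m" if "m < ?K" "i \<in> Ss ! m" for m i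
    proof -
      have "i < d"
        using that connected_components_subset[OF E Ss_nth] by blast
      then have "(?C *\<^sub>v c) $ i + (M *\<^sub>v x) $ i = 0"
        using arg_cong[OF sum0, of "\<lambda>u. u $ i"] M by simp
      then show ?thesis
        using C_mult[OF c that] by simp
    qed
    have "\<forall>S\<in>connected_components d E. \<forall>i\<in>S. \<forall>j\<in>S. (M *\<^sub>v x) $ i = (M *\<^sub>v x) $ j"
      using Mx unfolding Ss(2)[symmetric] by (metis in_set_conv_nth)
    then have x0: "x = 0\<^sub>v k"
      using inj x constant_on_connected_components_iff[OF E, of "\<lambda>i. (M *\<^sub>v x) $ i"] by blast
    \<comment> \<open>Any vertex of component \<open>m\<close> gives a row in which the kernel
      equation, with \<open>x = 0\<close>, reads \<open>c $ m = 0\<close>.\<close>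
    have "c $ m = 0" if m: "m < ?K" for m
    proof -
      obtain i where i: "i \<in> Ss ! m"
        using connected_components_nonempty[OF E Ss_nth[OF m]] by blast
      then have "i < d"
        using connected_components_subset[OF E Ss_nth[OF m]] by blast
      then show ?thesis
        using Mx[OF m i] M by (simp add: x0)
    qed
    then have "c = 0\<^sub>v ?K"
      using c by auto
    then show "v = 0\<^sub>v (?K + k)"
      unfolding v_eq x0 by auto
  qed
  finally show ?thesis .
qed

section \<open>The Laplacian and its quadratic form\<close>

lemma pair_vec_carrier: "pair_vec d \<alpha> \<in> carrier_vec d"
  by (simp add: pair_vec_def)

lemma pair_vec_scalar_prod:
  assumes "y \<in> carrier_vec d" "i < d" "j < d"
  shows "pair_vec d (i, j) \<bullet> y = y $ i - y $ j"
  using assms by (simp add: pair_vec_def minus_scalar_prod_distrib[of _ d])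

lemma laplacian_carrier: "laplacian d E n \<in> carrier_mat d d"
  by (simp add: laplacian_def)

lemma transpose_laplacian: "(laplacian d E n)\<^sup>T = laplacian d E n"
  by (rule eq_matI) (auto simp: laplacian_def ac_simps)

text \<open>The Laplacian is a weighted sum of rank-one matrices; exchanging the sum over
  coordinates with the sum over pairs collects each scalar product with a pair vector.\<close>

lemma laplacian_mult_vec:
  assumes y: "y \<in> carrier_vec d" and r: "r < d"
  shows "(laplacian d E n *\<^sub>v y) $ r =
    (\<Sum>\<alpha>\<in>E. real (n \<alpha>) * (pair_vec d \<alpha> \<bullet> y) * pair_vec d \<alpha> $ r) / real (\<Sum>\<alpha>\<in>E. n \<alpha>)"
proof -
  let ?v = "pair_vec d" and ?N = "real (\<Sum>\<alpha>\<in>E. n \<alpha>)"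
  have "(laplacian d E n *\<^sub>v y) $ r = (\<Sum>s = 0..<d. \<Sum>\<alpha>\<in>E. real (n \<alpha>) * (?v \<alpha> $ s * y $ s) * ?v \<alpha> $ r / ?N)"
    using y r unfolding laplacian_def
    by (simp add: scalar_prod_def sum_distrib_left sum_distrib_right sum_divide_distrib ac_simps)
  also have "\<dots> = (\<Sum>\<alpha>\<in>E. real (n \<alpha>) * (?v \<alpha> \<bullet> y) * ?v \<alpha> $ r / ?N)"
    using y by (subst sum.swap)
      (simp add: scalar_prod_def sum_distrib_left sum_distrib_right sum_divide_distrib)
  finally show ?thesis
    by (simp add: sum_divide_distrib)
qed

lemma laplacian_quadratic_form:
  assumes y: "y \<in> carrier_vec d"
  shows "y \<bullet> (laplacian d E n *\<^sub>v y) =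
    (\<Sum>\<alpha>\<in>E. real (n \<alpha>) * (pair_vec d \<alpha> \<bullet> y)\<^sup>2) / real (\<Sum>\<alpha>\<in>E. n \<alpha>)"
proof -
  let ?v = "pair_vec d" and ?N = "real (\<Sum>\<alpha>\<in>E. n \<alpha>)"
  have "y \<bullet> (laplacian d E n *\<^sub>v y) = (\<Sum>r = 0..<d. y $ r * (laplacian d E n *\<^sub>v y) $ r)"
    by (simp add: scalar_prod_def carrier_matD[OF laplacian_carrier])
  also have "\<dots> = (\<Sum>r = 0..<d. \<Sum>\<alpha>\<in>E. real (n \<alpha>) * (?v \<alpha> \<bullet> y) * (?v \<alpha> $ r * y $ r) / ?N)"
    by (simp add: laplacian_mult_vec[OF y] sum_distrib_left sum_divide_distrib ac_simps
        del: index_mult_mat_vec)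
  also have "\<dots> = (\<Sum>\<alpha>\<in>E. real (n \<alpha>) * (?v \<alpha> \<bullet> y) * (\<Sum>r = 0..<d. ?v \<alpha> $ r * y $ r) / ?N)"
    by (subst sum.swap) (simp add: sum_distrib_left sum_divide_distrib)
  also have "\<dots> = (\<Sum>\<alpha>\<in>E. real (n \<alpha>) * (?v \<alpha> \<bullet> y)\<^sup>2 / ?N)"
    using y by (simp add: scalar_prod_def power2_eq_square mult.assoc)
  finally show ?thesis
    by (simp add: sum_divide_distrib)
qed

text \<open>Each rank-one term sends \<open>y\<close> to a multiple of \<open>y $ i - y $ j\<close>,
  so all terms vanish together. This turns equality along the queried pairs into membership in the
  kernel of \<open>W\<close>.\<close>

lemma laplacian_mult_vec_eq_0:
  assumes y: "y \<in> carrier_vec d" and E: "E \<subseteq> {..<d} \<times> {..<d}" and const: "\<forall>(i, j)\<in>E. y $ i = y $ j"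
  shows "laplacian d E n *\<^sub>v y = 0\<^sub>v d"
proof (rule eq_vecI)
  have "pair_vec d \<alpha> \<bullet> y = 0" if "\<alpha> \<in> E" for \<alpha>
    using E const that y by (cases \<alpha>) (fastforce simp: pair_vec_scalar_prod)
  then show "(laplacian d E n *\<^sub>v y) $ r = 0\<^sub>v d $ r" if "r < dim_vec (0\<^sub>v d :: real vec)" for r
    using that by (simp add: laplacian_mult_vec[OF y] del: index_mult_mat_vec)
qed (simp add: carrier_matD[OF laplacian_carrier])

lemma laplacian_quadratic_form_nonneg:
  "y \<in> carrier_vec d \<Longrightarrow> y \<bullet> (laplacian d E n *\<^sub>v y) \<ge> 0"
  by (auto simp: laplacian_quadratic_form intro!: divide_nonneg_nonneg sum_nonneg)

lemma laplacian_quadratic_form_eq_0_iff: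
  assumes y: "y \<in> carrier_vec d" and E: "E \<subseteq> {..<d} \<times> {..<d}" and n: "\<And>\<alpha>. \<alpha> \<in> E \<Longrightarrow> n \<alpha> \<ge> 1"
  shows "y \<bullet> (laplacian d E n *\<^sub>v y) = 0 \<longleftrightarrow> (\<forall>(i, j)\<in>E. y $ i = y $ j)"
proof -
  have fin: "finite E"
    using E by (rule finite_subset) simp
  \<comment> \<open>If \<open>E\<close> is empty, the total weight is 0 and the quotient is 0 by the
    convention for division, in agreement with the vacuous right-hand side. Otherwise the
    denominator is nonzero and the numerator decides.\<close>
  have N: "(\<Sum>\<alpha>\<in>E. n \<alpha>) = 0 \<longleftrightarrow> E = {}"
    using fin n by fastforce
  have "y \<bullet> (laplacian d E n *\<^sub>v y) = 0 \<longleftrightarrow> (\<forall>\<alpha>\<in>E. real (n \<alpha>) * (pair_vec d \<alpha> \<bullet> y)\<^sup>2 = 0)"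
    unfolding laplacian_quadratic_form[OF y] divide_eq_0_iff of_nat_eq_0_iff N
    using sum_nonneg_eq_0_iff[OF fin, of "\<lambda>\<alpha>. real (n \<alpha>) * (pair_vec d \<alpha> \<bullet> y)\<^sup>2"] by auto
  also have "\<dots> \<longleftrightarrow> (\<forall>\<alpha>\<in>E. pair_vec d \<alpha> \<bullet> y = 0)"
    using n by fastforce
  also have "\<dots> \<longleftrightarrow> (\<forall>(i, j)\<in>E. y $ i = y $ j)"
    using E y by (fastforce simp: pair_vec_scalar_prod)
  finally show ?thesis .
qed

text \<open>The logistic function is injective for positive \<sigma>, so equal probabilities mean
  equal utilities. The utility is linear in the parameter and equals the difference of two
  coordinates of \<open>F *\<^sub>v w\<close>.\<close>

lemma choice_prob_eq_iff:
  assumes F: "F \<in> carrier_mat d p" and "\<sigma> > 0" "i < d" "j < d"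
    and w: "w \<in> carrier_vec p" and w': "w' \<in> carrier_vec p"
  shows "choice_prob \<sigma> F (i, j) w = choice_prob \<sigma> F (i, j) w' \<longleftrightarrow>
    (F *\<^sub>v (w - w')) $ i = (F *\<^sub>v (w - w')) $ j"
proof -
  have utility: "u \<bullet> feature_diff F (i, j) = (F *\<^sub>v u) $ i - (F *\<^sub>v u) $ j"
    if u: "u \<in> carrier_vec p" for u
  proof -
    have "u \<bullet> feature_diff F (i, j) = feature_diff F (i, j) \<bullet> u"
      using u F by (intro comm_scalar_prod[of _ p])
        (auto simp: feature_diff_def intro!: mult_mat_vec_carrier pair_vec_carrier)
    also have "\<dots> = pair_vec d (i, j) \<bullet> (F *\<^sub>v u)"
      using F u by (simp add: feature_diff_def transpose_vec_mult_scalar[OF F u pair_vec_carrier])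
    also have "\<dots> = (F *\<^sub>v u) $ i - (F *\<^sub>v u) $ j"
      using pair_vec_scalar_prod mult_mat_vec_carrier[OF F u] assms(3,4) by blast
    finally show ?thesis .
  qed
  have "1 + exp x \<noteq> 0" for x :: real
    using exp_gt_zero[of x] by linarith
  then have "choice_prob \<sigma> F (i, j) w = choice_prob \<sigma> F (i, j) w' \<longleftrightarrow>
      w \<bullet> feature_diff F (i, j) = w' \<bullet> feature_diff F (i, j)"
    using \<open>\<sigma> > 0\<close> by (simp add: choice_prob_def field_simps)
  then show ?thesis
    using assms by (auto simp: utility mult_minus_distrib_mat_vec[OF F w w'])
qed

subsection \<open>Symmetric matrices\<close>

lemma congruence_quadratic_form:
  fixes L M :: "'a::comm_ring_1 mat"
  assumes L: "L \<in> carrier_mat d d" and M: "M \<in> carrier_mat d k" and x: "x \<in> carrier_vec k"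
  shows "x \<bullet> ((M\<^sup>T * L * M) *\<^sub>v x) = (M *\<^sub>v x) \<bullet> (L *\<^sub>v (M *\<^sub>v x))"
proof -
  have MT: "M\<^sup>T \<in> carrier_mat k d"
    using M by simp
  have Mx: "M *\<^sub>v x \<in> carrier_vec d"
    using M x by (rule mult_mat_vec_carrier)
  have LMx: "L *\<^sub>v (M *\<^sub>v x) \<in> carrier_vec d"
    using L Mx by (rule mult_mat_vec_carrier)
  have "(M\<^sup>T * L * M) *\<^sub>v x = M\<^sup>T *\<^sub>v (L *\<^sub>v (M *\<^sub>v x))"
    by (simp add: assoc_mult_mat_vec[OF mult_carrier_mat[OF MT L] M x] assoc_mult_mat_vec[OF MT L Mx])
  then have "x \<bullet> ((M\<^sup>T * L * M) *\<^sub>v x) = (M\<^sup>T *\<^sub>v (L *\<^sub>v (M *\<^sub>v x))) \<bullet> x"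
    using comm_scalar_prod[OF x mult_mat_vec_carrier[OF MT LMx]] by simp
  also have "\<dots> = (L *\<^sub>v (M *\<^sub>v x)) \<bullet> (M *\<^sub>v x)"
    using M x LMx by (rule transpose_vec_mult_scalar)
  also have "\<dots> = (M *\<^sub>v x) \<bullet> (L *\<^sub>v (M *\<^sub>v x))"
    using LMx Mx by (rule comm_scalar_prod)
  finally show ?thesis .
qed

text \<open>For symmetric \<open>W\<close> the range is orthogonal to the kernel: if
  \<open>W c = 0\<close>, then \<open>c \<bullet> (W z) = (W c) \<bullet> z = 0\<close>. Here
  \<open>c\<close> runs through the columns of \<open>Qn\<close>.\<close>

lemma range_kernel_orthogonal:
  fixes W Qp Qn :: "'a::field mat"
  assumes W: "W \<in> carrier_mat k k" "W\<^sup>T = W"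
    and Qp: "Qp \<in> carrier_mat k q" "vec_space.col_space k Qp = vec_space.col_space k W"
    and Qn: "Qn \<in> carrier_mat k r" "vec_space.col_space k Qn = mat_kernel W"
    and x: "x \<in> carrier_vec q"
  shows "Qn\<^sup>T *\<^sub>v (Qp *\<^sub>v x) = 0\<^sub>v r"
proof (rule eq_vecI)
  have "Qp *\<^sub>v x \<in> vec_space.col_space k W"
    unfolding Qp(2)[symmetric] vec_space_col_space_iff[OF Qp(1)] using x by blast
  then obtain z where z: "z \<in> carrier_vec k" "W *\<^sub>v z = Qp *\<^sub>v x"
    unfolding vec_space_col_space_iff[OF W(1)] by blast
  fix j assume "j < dim_vec (0\<^sub>v r :: 'a vec)"
  then have j: "j < r"
    by simp
  have c: "col Qn j \<in> carrier_vec k"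
    using Qn(1) by auto
  have "col Qn j \<in> mat_kernel W"
    unfolding Qn(2)[symmetric] vec_space_col_space_iff[OF Qn(1)]
    using mult_mat_unit_vec[OF Qn(1) j] by auto
  then have ker: "W *\<^sub>v col Qn j = 0\<^sub>v k"
    using mat_kernelD[OF W(1)] by blast
  have "(Qn\<^sup>T *\<^sub>v (Qp *\<^sub>v x)) $ j = col Qn j \<bullet> (W *\<^sub>v z)"
    using Qn(1) j by (simp add: z(2))
  also have "\<dots> = (W\<^sup>T *\<^sub>v col Qn j) \<bullet> z"
    using W(1) z(1) c by (rule transpose_vec_mult_scalar[symmetric])
  also have "\<dots> = 0"
    using z(1) by (simp add: W(2) ker)
  finally show "(Qn\<^sup>T *\<^sub>v (Qp *\<^sub>v x)) $ j = 0\<^sub>v r $ j"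
    using j by simp
qed (use Qn in simp)

text \<open>The residual \<open>y\<close> of the projection is orthogonal to the range of
  \<open>W\<close>, which contains \<open>W (W y)\<close>. By symmetry
  \<open>|W y|^2 = (W (W y)) \<bullet> y = 0\<close>.\<close>

lemma symmetric_mult_range_projection:
  fixes W Q :: "real mat"
  assumes W: "W \<in> carrier_mat k k" "W\<^sup>T = W"
    and Q: "Q \<in> carrier_mat k q" "orthonormal_cols Q" "vec_space.col_space k Q = vec_space.col_space k W"
    and x: "x \<in> carrier_vec k"
  shows "W *\<^sub>v (x - Q *\<^sub>v (Q\<^sup>T *\<^sub>v x)) = 0\<^sub>v k"
proof -
  have QT: "Q\<^sup>T \<in> carrier_mat q k"
    using Q by simp
  have Qx: "Q\<^sup>T *\<^sub>v x \<in> carrier_vec q"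
    using QT x by (rule mult_mat_vec_carrier)
  have QQx: "Q *\<^sub>v (Q\<^sup>T *\<^sub>v x) \<in> carrier_vec k"
    using Q(1) Qx by (rule mult_mat_vec_carrier)
  define y where "y = x - Q *\<^sub>v (Q\<^sup>T *\<^sub>v x)"
  have y: "y \<in> carrier_vec k"
    unfolding y_def using x QQx by (rule minus_carrier_vec)
  have Qy: "Q\<^sup>T *\<^sub>v y = 0\<^sub>v q"
    unfolding y_def mult_minus_distrib_mat_vec[OF QT x QQx] orthonormal_cols_cancel[OF Q(1,2) Qx]
    using Qx by simp
  have Wy: "W *\<^sub>v y \<in> carrier_vec k"
    using W(1) y by (rule mult_mat_vec_carrier)
  \<comment> \<open>\<open>W\<close> is applied twice because moving one factor across in
    \<open>(W y) \<bullet> (W y)\<close> leaves exactly this vector paired with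
    \<open>y\<close>.\<close>
  have "W *\<^sub>v (W *\<^sub>v y) \<in> vec_space.col_space k Q"
    unfolding Q(3) vec_space_col_space_iff[OF W(1)] using Wy by blast
  then obtain z where z: "z \<in> carrier_vec q" "Q *\<^sub>v z = W *\<^sub>v (W *\<^sub>v y)"
    unfolding vec_space_col_space_iff[OF Q(1)] by blast
  have "(W *\<^sub>v y) \<bullet> (W *\<^sub>v y) = (W\<^sup>T *\<^sub>v (W *\<^sub>v y)) \<bullet> y"
    using W(1) y Wy by (rule transpose_vec_mult_scalar[symmetric])
  also have "\<dots> = (Q\<^sup>T\<^sup>T *\<^sub>v z) \<bullet> y"
    by (simp add: W(2) z(2))
  also have "\<dots> = z \<bullet> (Q\<^sup>T *\<^sub>v y)"
    using QT y z(1) by (rule transpose_vec_mult_scalar)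
  also have "\<dots> = 0"
    using z(1) by (simp add: Qy)
  finally show ?thesis
    using scalar_prod_self_eq_0_iff[OF Wy] by (simp add: y_def)
qed

subsection \<open>Identifiability\<close>

theorem corollary2p1:
  fixes d p l d\<^sub>\<theta> K :: nat
    and \<phi> :: "nat \<Rightarrow> real vec"
    and \<AA> A V W C :: "real mat"
    and b w\<^sub>o :: "real vec"
    and \<sigma> :: real
    and E :: "(nat \<times> nat) set"
    and n :: "nat \<times> nat \<Rightarrow> nat"
    and comps :: "nat set list"
  assumes features: "\<And>i. i < d \<Longrightarrow> \<phi> i \<in> carrier_vec p"
    and \<AA>: "\<AA> = mat_of_rows p (map \<phi> [0..<d])"
    and \<sigma>: "0 < \<sigma>"
    and A: "A \<in> carrier_mat l p"
    and b: "b \<in> carrier_vec l"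
    and consistent: "\<exists>w\<in>carrier_vec p. A *\<^sub>v w = b"
    and d\<^sub>\<theta>: "d\<^sub>\<theta> = p - vec_space.rank l A"
    and V: "V \<in> carrier_mat p d\<^sub>\<theta>"
    and V_orthonormal: "orthonormal_cols V"
    and V_span: "vec_space.col_space p V = mat_kernel A"
    and w\<^sub>o: "w\<^sub>o = pseudoinverse A *\<^sub>v b"
    and E: "E \<subseteq> {(i, j). i < j \<and> j < d}"
    and E_nonempty: "E \<noteq> {}"
    and n: "\<And>\<alpha>. \<alpha> \<in> E \<Longrightarrow> n \<alpha> \<ge> 1"
    and comps: "distinct comps" "set comps = connected_components d E"
    and K: "K = card (connected_components d E)"
    and C: "C = mat_of_cols d (map (indicator_vec d) comps)"
    and W: "W = V\<^sup>T * \<AA>\<^sup>T * laplacian d E n * \<AA> * V"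
  shows
    "(vec_space.rank d (append_cols C (\<AA> * V)) = d\<^sub>\<theta> + K \<longleftrightarrow> positive_definite W) \<and>
     (vec_space.rank d (append_cols C (\<AA> * V)) \<noteq> d\<^sub>\<theta> + K \<longrightarrow>
      (\<forall>q r Qp Qn.
         Qp \<in> carrier_mat d\<^sub>\<theta> q \<and> orthonormal_cols Qp \<and>
         vec_space.col_space d\<^sub>\<theta> Qp = vec_space.col_space d\<^sub>\<theta> W \<and>
         Qn \<in> carrier_mat d\<^sub>\<theta> r \<and> orthonormal_cols Qn \<and>
         vec_space.col_space d\<^sub>\<theta> Qn = mat_kernel W \<longrightarrow>
         (\<forall>w\<in>carrier_vec p. \<forall>w'\<in>carrier_vec p.
            A *\<^sub>v w = b \<and> (V * Qn)\<^sup>T *\<^sub>v w = 0\<^sub>v r \<and>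
            A *\<^sub>v w' = b \<and> (V * Qn)\<^sup>T *\<^sub>v w' = 0\<^sub>v r \<and>
            (\<forall>\<alpha>\<in>E. choice_prob \<sigma> \<AA> \<alpha> w = choice_prob \<sigma> \<AA> \<alpha> w') \<longrightarrow>
            w = w') \<and>
         (\<forall>\<theta>\<in>carrier_vec d\<^sub>\<theta>.
            let ws = w\<^sub>o + V *\<^sub>v \<theta>;
                wt = w\<^sub>o + V *\<^sub>v (Qp *\<^sub>v (Qp\<^sup>T *\<^sub>v \<theta>));
                P = (\<lambda>w. w \<in> carrier_vec p \<and> A *\<^sub>v w = b \<and> (V * Qn)\<^sup>T *\<^sub>v w = 0\<^sub>v r \<and>
                         (\<forall>\<alpha>\<in>E. choice_prob \<sigma> \<AA> \<alpha> w = choice_prob \<sigma> \<AA> \<alpha> ws))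
            in P wt \<and> (\<forall>w. P w \<longrightarrow> w = wt))))"
proof -
  define M where "M = \<AA> * V"
  have FC: "\<AA> \<in> carrier_mat d p"
    by (simp add: \<AA> mat_of_rows_def)
  have VT: "V\<^sup>T \<in> carrier_mat d\<^sub>\<theta> p" and FT: "\<AA>\<^sup>T \<in> carrier_mat p d"
    using V FC by simp_all
  have M: "M \<in> carrier_mat d d\<^sub>\<theta>"
    unfolding M_def using FC V by (rule mult_carrier_mat)
  have MT: "M\<^sup>T \<in> carrier_mat d\<^sub>\<theta> d"
    using M by simp
  have Mx: "M *\<^sub>v x = \<AA> *\<^sub>v (V *\<^sub>v x)" if "x \<in> carrier_vec d\<^sub>\<theta>" for x
    unfolding M_def using FC V that by (rule assoc_mult_mat_vec)
  note L = laplacian_carrier[of d E n]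
  have E2: "E \<subseteq> {..<d} \<times> {..<d}"
    using E by auto
  have K_eq: "K = length comps"
    using comps distinct_card[OF comps(1)] by (simp add: K)
  have C_eq: "C = component_matrix d comps"
    by (simp add: C component_matrix_def)
  \<comment> \<open>Regrouped as a congruence of the Laplacian, \<open>W\<close> inherits its
    symmetry, and its form at \<open>x\<close> is the Laplacian form at \<open>M x\<close>.\<close>
  have W_eq: "W = M\<^sup>T * laplacian d E n * M"
    unfolding W M_def transpose_mult[OF FC V]
    using assoc_mult_mat[OF mult_carrier_mat[OF mult_carrier_mat[OF VT FT] L] FC V] by simp
  have Wc: "W \<in> carrier_mat d\<^sub>\<theta> d\<^sub>\<theta>"
    unfolding W_eq using mult_carrier_mat[OF MT L] M by (rule mult_carrier_mat)
  have Wsym: "W\<^sup>T = W"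
    unfolding W_eq transpose_mult[OF mult_carrier_mat[OF MT L] M] transpose_mult[OF MT L]
      transpose_laplacian
    using assoc_mult_mat[OF MT L M] by simp

  \<comment> \<open>This predicate is the hinge of the proof: it describes the kernel of the block
    matrix, the zeros of the form of \<open>W\<close>, and the directions that leave all choice
    probabilities unchanged.\<close>
  define edge_const where "edge_const x \<longleftrightarrow> (\<forall>(i, j)\<in>E. (M *\<^sub>v x) $ i = (M *\<^sub>v x) $ j)" for x
  have form_nonneg: "x \<bullet> (W *\<^sub>v x) \<ge> 0" and form_0: "x \<bullet> (W *\<^sub>v x) = 0 \<longleftrightarrow> edge_const x"
    if "x \<in> carrier_vec d\<^sub>\<theta>" for x
    unfolding W_eq congruence_quadratic_form[OF L M that] edge_const_def
    by (rule laplacian_quadratic_form_nonneg[OF mult_mat_vec_carrier[OF M that]])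
      (rule laplacian_quadratic_form_eq_0_iff[OF mult_mat_vec_carrier[OF M that] E2 n])

  have rank_iff: "vec_space.rank d (append_cols C (\<AA> * V)) = d\<^sub>\<theta> + K \<longleftrightarrow> positive_definite W"
  proof -
    have "vec_space.rank d (append_cols C (\<AA> * V)) = d\<^sub>\<theta> + K \<longleftrightarrow>
        (\<forall>x\<in>carrier_vec d\<^sub>\<theta>. edge_const x \<longrightarrow> x = 0\<^sub>v d\<^sub>\<theta>)"
      unfolding C_eq K_eq edge_const_def M_def[symmetric]
      by (rule rank_append_component_matrix_iff[OF E2 comps M])
    \<comment> \<open>The form is nonnegative, so being positive at \<open>x\<close> only means not
      vanishing there.\<close>
    also have "\<dots> \<longleftrightarrow> (\<forall>x\<in>carrier_vec d\<^sub>\<theta>. x \<noteq> 0\<^sub>v d\<^sub>\<theta> \<longrightarrow> x \<bullet> (W *\<^sub>v x) > 0)"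
    proof (rule ball_cong[OF refl])
      fix x :: "real vec" assume "x \<in> carrier_vec d\<^sub>\<theta>"
      then show "(edge_const x \<longrightarrow> x = 0\<^sub>v d\<^sub>\<theta>) \<longleftrightarrow> (x \<noteq> 0\<^sub>v d\<^sub>\<theta> \<longrightarrow> x \<bullet> (W *\<^sub>v x) > 0)"
        using form_nonneg form_0 by (auto simp: less_le)
    qed
    also have "\<dots> \<longleftrightarrow> positive_definite W"
      using Wc Wsym by (simp add: positive_definite_def)
    finally show ?thesis .
  qed

  obtain w0 where w0: "w0 \<in> carrier_vec p" "A *\<^sub>v w0 = b"
    using consistent by blast
  have pinv: "is_pseudoinverse A (pseudoinverse A)" and V_pinv: "V\<^sup>T * pseudoinverse A = 0\<^sub>m d\<^sub>\<theta> l"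
    using is_pseudoinverse_pseudoinverse[OF A V V_orthonormal V_span]
      transpose_kernel_mult_pseudoinverse[OF A V V_orthonormal V_span] by simp_all
  have pc: "pseudoinverse A \<in> carrier_mat p l" and ApA: "A * pseudoinverse A * A = A"
    using pinv A by (auto simp: is_pseudoinverse_def)
  have wo_c: "w\<^sub>o \<in> carrier_vec p"
    unfolding w\<^sub>o using pc b by (rule mult_mat_vec_carrier)
  \<comment> \<open>Consistency enters here: with \<open>b = A w0\<close>, the first Penrose
    condition turns the pseudoinverse image of \<open>b\<close> into a solution.\<close>
  have A_wo: "A *\<^sub>v w\<^sub>o = b"
  proof -
    have "A *\<^sub>v w\<^sub>o = (A * pseudoinverse A) *\<^sub>v (A *\<^sub>v w0)"
      unfolding w\<^sub>o w0(2) using A pc b by (rule assoc_mult_mat_vec[symmetric])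
    also have "\<dots> = (A * pseudoinverse A * A) *\<^sub>v w0"
      using mult_carrier_mat[OF A pc] A w0(1) by (rule assoc_mult_mat_vec[symmetric])
    finally show ?thesis
      by (simp add: ApA w0(2))
  qed
  \<comment> \<open>\<open>w\<^sub>o\<close> is orthogonal to the kernel of \<open>A\<close>, so
    applying \<open>V\<^sup>T\<close> to \<open>w\<^sub>o + V *\<^sub>v \<eta>\<close> recovers
    \<eta>.\<close>
  have V_wo: "V\<^sup>T *\<^sub>v w\<^sub>o = 0\<^sub>v d\<^sub>\<theta>"
    unfolding w\<^sub>o assoc_mult_mat_vec[OF VT pc b, symmetric] V_pinv using b by auto

  have choice_eq: "(\<forall>\<alpha>\<in>E. choice_prob \<sigma> \<AA> \<alpha> w = choice_prob \<sigma> \<AA> \<alpha> w') \<longleftrightarrow> edge_const x"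
    if "w \<in> carrier_vec p" "w' \<in> carrier_vec p" "x \<in> carrier_vec d\<^sub>\<theta>" "w - w' = V *\<^sub>v x" for w w' x
  proof -
    have "choice_prob \<sigma> \<AA> (i, j) w = choice_prob \<sigma> \<AA> (i, j) w' \<longleftrightarrow> (M *\<^sub>v x) $ i = (M *\<^sub>v x) $ j"
      if "(i, j) \<in> E" for i j
      using choice_prob_eq_iff[OF FC \<sigma> _ _ \<open>w \<in> carrier_vec p\<close> \<open>w' \<in> carrier_vec p\<close>, of i j] that E2
        Mx[OF \<open>x \<in> carrier_vec d\<^sub>\<theta>\<close>] \<open>w - w' = V *\<^sub>v x\<close> by auto
    then show ?thesis
      unfolding edge_const_def by auto
  qed

  have moreover_part:
    "(\<forall>w\<in>carrier_vec p. \<forall>w'\<in>carrier_vec p.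
        A *\<^sub>v w = b \<and> (V * Qn)\<^sup>T *\<^sub>v w = 0\<^sub>v r \<and>
        A *\<^sub>v w' = b \<and> (V * Qn)\<^sup>T *\<^sub>v w' = 0\<^sub>v r \<and>
        (\<forall>\<alpha>\<in>E. choice_prob \<sigma> \<AA> \<alpha> w = choice_prob \<sigma> \<AA> \<alpha> w') \<longrightarrow>
        w = w') \<and>
     (\<forall>\<theta>\<in>carrier_vec d\<^sub>\<theta>.
        let ws = w\<^sub>o + V *\<^sub>v \<theta>;
            wt = w\<^sub>o + V *\<^sub>v (Qp *\<^sub>v (Qp\<^sup>T *\<^sub>v \<theta>));
            P = (\<lambda>w. w \<in> carrier_vec p \<and> A *\<^sub>v w = b \<and> (V * Qn)\<^sup>T *\<^sub>v w = 0\<^sub>v r \<and>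
                     (\<forall>\<alpha>\<in>E. choice_prob \<sigma> \<AA> \<alpha> w = choice_prob \<sigma> \<AA> \<alpha> ws))
        in P wt \<and> (\<forall>w. P w \<longrightarrow> w = wt))"
    if Qp: "Qp \<in> carrier_mat d\<^sub>\<theta> q" "orthonormal_cols Qp"
        "vec_space.col_space d\<^sub>\<theta> Qp = vec_space.col_space d\<^sub>\<theta> W"
      and Qn: "Qn \<in> carrier_mat d\<^sub>\<theta> r" "orthonormal_cols Qn" "vec_space.col_space d\<^sub>\<theta> Qn = mat_kernel W"
    for q r Qp Qn
  proof -
    have QnT: "Qn\<^sup>T \<in> carrier_mat r d\<^sub>\<theta>" and QpT: "Qp\<^sup>T \<in> carrier_mat q d\<^sub>\<theta>"
      using Qp Qn by simp_all
    have VQ: "(V * Qn)\<^sup>T *\<^sub>v w = Qn\<^sup>T *\<^sub>v (V\<^sup>T *\<^sub>v w)" if "w \<in> carrier_vec p" for w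
      unfolding transpose_mult[OF V Qn(1)] using QnT VT that by (rule assoc_mult_mat_vec)
    have VQc: "(V * Qn)\<^sup>T \<in> carrier_mat r p"
      using mult_carrier_mat[OF V Qn(1)] by simp
    \<comment> \<open>The difference of the two solutions is \<open>V x\<close>. Equal probabilities
      put \<open>x\<close> in the kernel of \<open>W\<close>, so \<open>x = Qn y\<close>, while the
      added constraint gives \<open>Qn\<^sup>T x = 0\<close> and hence \<open>y = 0\<close>.\<close>
    have identifiable: "w = w'"
      if w: "w \<in> carrier_vec p" "A *\<^sub>v w = b" "(V * Qn)\<^sup>T *\<^sub>v w = 0\<^sub>v r"
        and w': "w' \<in> carrier_vec p" "A *\<^sub>v w' = b" "(V * Qn)\<^sup>T *\<^sub>v w' = 0\<^sub>v r"
        and choice: "\<forall>\<alpha>\<in>E. choice_prob \<sigma> \<AA> \<alpha> w = choice_prob \<sigma> \<AA> \<alpha> w'" for w w'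
    proof -
      have ww: "w - w' \<in> carrier_vec p"
        using w(1) w'(1) by simp
      have "A *\<^sub>v (w - w') = 0\<^sub>v l"
        using b by (simp add: mult_minus_distrib_mat_vec[OF A w(1) w'(1)] w(2) w'(2))
      then have "w - w' \<in> vec_space.col_space p V"
        unfolding V_span using mat_kernelI[OF A ww] by blast
      then obtain x where x: "x \<in> carrier_vec d\<^sub>\<theta>" "V *\<^sub>v x = w - w'"
        unfolding vec_space_col_space_iff[OF V] by blast
      have "Qn\<^sup>T *\<^sub>v x = (V * Qn)\<^sup>T *\<^sub>v (w - w')"
        using VQ[OF ww] orthonormal_cols_cancel[OF V V_orthonormal x(1)] by (simp only: x(2))
      also have "\<dots> = 0\<^sub>v r"
        unfolding mult_minus_distrib_mat_vec[OF VQc w(1) w'(1)] w(3) w'(3) by simp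
      finally have Qn_x: "Qn\<^sup>T *\<^sub>v x = 0\<^sub>v r" .
      have "edge_const x"
        using choice_eq[OF w(1) w'(1) x(1)] x(2) choice by simp
      then have "laplacian d E n *\<^sub>v (M *\<^sub>v x) = 0\<^sub>v d"
        using laplacian_mult_vec_eq_0[OF mult_mat_vec_carrier[OF M x(1)] E2] by (simp add: edge_const_def)
      then have "W *\<^sub>v x = 0\<^sub>v d\<^sub>\<theta>"
        unfolding W_eq assoc_mult_mat_vec[OF mult_carrier_mat[OF MT L] M x(1)]
          assoc_mult_mat_vec[OF MT L mult_mat_vec_carrier[OF M x(1)]]
        using MT by auto
      then have "x \<in> vec_space.col_space d\<^sub>\<theta> Qn"
        unfolding Qn(3) using mat_kernelI[OF Wc x(1)] by blast
      then obtain y where y: "y \<in> carrier_vec r" "Qn *\<^sub>v y = x"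
        unfolding vec_space_col_space_iff[OF Qn(1)] by blast
      have "y = 0\<^sub>v r"
        using orthonormal_cols_cancel[OF Qn(1,2) y(1)] by (simp add: y(2) Qn_x)
      then have "x = 0\<^sub>v d\<^sub>\<theta>"
        unfolding y(2)[symmetric] using Qn(1) by auto
      then have diff: "w - w' = 0\<^sub>v p"
        unfolding x(2)[symmetric] using V by auto
      show ?thesis
      proof (rule eq_vecI)
        fix i assume "i < dim_vec w'"
        then show "w $ i = w' $ i"
          using arg_cong[OF diff, of "\<lambda>u. u $ i"] w'(1) by simp
      qed (use w(1) w'(1) in simp)
    qed
    \<comment> \<open>Existence: the projected parameter meets both linear systems and keeps the
      probabilities of the original one.\<close>
    have "w\<^sub>o + V *\<^sub>v (Qp *\<^sub>v (Qp\<^sup>T *\<^sub>v \<theta>)) \<in> carrier_vec p \<and>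
        A *\<^sub>v (w\<^sub>o + V *\<^sub>v (Qp *\<^sub>v (Qp\<^sup>T *\<^sub>v \<theta>))) = b \<and>
        (V * Qn)\<^sup>T *\<^sub>v (w\<^sub>o + V *\<^sub>v (Qp *\<^sub>v (Qp\<^sup>T *\<^sub>v \<theta>))) = 0\<^sub>v r \<and>
        (\<forall>\<alpha>\<in>E. choice_prob \<sigma> \<AA> \<alpha> (w\<^sub>o + V *\<^sub>v (Qp *\<^sub>v (Qp\<^sup>T *\<^sub>v \<theta>))) =
          choice_prob \<sigma> \<AA> \<alpha> (w\<^sub>o + V *\<^sub>v \<theta>))"
      if \<theta>: "\<theta> \<in> carrier_vec d\<^sub>\<theta>" for \<theta>
    proof -
      define \<eta> where "\<eta> = Qp *\<^sub>v (Qp\<^sup>T *\<^sub>v \<theta>)"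
      have Qp\<theta>: "Qp\<^sup>T *\<^sub>v \<theta> \<in> carrier_vec q"
        using QpT \<theta> by (rule mult_mat_vec_carrier)
      have \<eta>: "\<eta> \<in> carrier_vec d\<^sub>\<theta>"
        unfolding \<eta>_def using Qp(1) Qp\<theta> by (rule mult_mat_vec_carrier)
      have V\<eta>: "V *\<^sub>v \<eta> \<in> carrier_vec p" and V\<theta>: "V *\<^sub>v \<theta> \<in> carrier_vec p"
        using mult_mat_vec_carrier[OF V] \<eta> \<theta> by blast+
      have "V *\<^sub>v \<eta> \<in> mat_kernel A"
        unfolding V_span[symmetric] vec_space_col_space_iff[OF V] using \<eta> by blast
      then have "A *\<^sub>v (V *\<^sub>v \<eta>) = 0\<^sub>v l"
        using mat_kernelD[OF A] by blast
      then have feasible: "A *\<^sub>v (w\<^sub>o + V *\<^sub>v \<eta>) = b"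
        using b by (simp add: mult_add_distrib_mat_vec[OF A wo_c V\<eta>] A_wo)
      have carrier: "w\<^sub>o + V *\<^sub>v \<eta> \<in> carrier_vec p" "w\<^sub>o + V *\<^sub>v \<theta> \<in> carrier_vec p"
        using wo_c V\<eta> V\<theta> by simp_all
      have "V\<^sup>T *\<^sub>v (w\<^sub>o + V *\<^sub>v \<eta>) = \<eta>"
        using \<eta> by (simp add: mult_add_distrib_mat_vec[OF VT wo_c V\<eta>] V_wo
          orthonormal_cols_cancel[OF V V_orthonormal \<eta>])
      then have "(V * Qn)\<^sup>T *\<^sub>v (w\<^sub>o + V *\<^sub>v \<eta>) = Qn\<^sup>T *\<^sub>v \<eta>"
        using VQ carrier(1) by simp
      also have "\<dots> = 0\<^sub>v r"
        unfolding \<eta>_def by (rule range_kernel_orthogonal[OF Wc Wsym Qp(1,3) Qn(1,3) Qp\<theta>])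
      finally have orth: "(V * Qn)\<^sup>T *\<^sub>v (w\<^sub>o + V *\<^sub>v \<eta>) = 0\<^sub>v r" .
      have diff: "\<theta> - \<eta> \<in> carrier_vec d\<^sub>\<theta>"
        using \<theta> \<eta> by simp
      \<comment> \<open>Projecting onto the range of \<open>W\<close> moves \<theta> only within the
        kernel of \<open>W\<close>; there the form vanishes, so no queried probability
        changes.\<close>
      have "W *\<^sub>v (\<theta> - \<eta>) = 0\<^sub>v d\<^sub>\<theta>"
        unfolding \<eta>_def by (rule symmetric_mult_range_projection[OF Wc Wsym Qp \<theta>])
      then have "edge_const (\<theta> - \<eta>)"
        using form_0[OF diff] diff by simp
      moreover have "(w\<^sub>o + V *\<^sub>v \<theta>) - (w\<^sub>o + V *\<^sub>v \<eta>) = V *\<^sub>v (\<theta> - \<eta>)"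
        unfolding mult_minus_distrib_mat_vec[OF V \<theta> \<eta>] using wo_c V\<theta> V\<eta> by (intro eq_vecI) auto
      ultimately show ?thesis
        using carrier feasible orth choice_eq[OF carrier(2,1) diff] by (simp add: \<eta>_def[symmetric])
    qed
    \<comment> \<open>Uniqueness: any competitor has the probabilities of the original parameter,
      hence those of the projected one, and identifiability applies to the two.\<close>
    then show ?thesis
      unfolding Let_def using identifiable by (intro conjI ballI allI impI) metis+
  qed
  show ?thesis
    using rank_iff moreover_part by blast
qed

end
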